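(* Let $k>0$ be real and let $\lambda,\alpha,\beta\in\mathbb{C}$ with $\beta\notin\{0,-k,-2k,\dots\}$. Then $$\sum_{n=0}^\infty\frac{(\lambda)_{n,k}}{n!}\,{}_2F_{1,k}\left[\begin{array}{c}\lambda+nk,\ \alpha\\ \beta\end{array};x\right]t^n=(1-kt)^{-\frac{\lambda}{k}}\,{}_2F_{1,k}\left[\begin{array}{c}\lambda,\ \alpha\\ \beta\end{array};\frac{x}{1-kt}\right],$$ where $|x|<\frac1k\min\{1,1-kt\}$.
   Context: For real $k>0$, $a\in\mathbb{C}$ and an integer $n\ge 1$, the Pochhammer $k$-symbol is $(a)_{n,k}=a(a+k)(a+2k)\cdots(a+(n-1)k)$, and $(a)_{0,k}=1$. The $k$-hypergeometric function is $${}_2F_{1,k}\left[\begin{array}{c}\alpha,\ \beta\\ \gamma\end{array};x\right]=\sum_{n=0}^\infty\frac{(\alpha)_{n,k}(\beta)_{n,k}}{(\gamma)_{n,k}}\frac{x^n}{n!},$$ with $\gamma$ such that no denominator vanishes.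
   Formalization: The sum over n can diverge for t<0 (k=1, x=0, λ=1, t=-5), so the identity is stated whenever that sum converges; its convergence is proved for k|t|<min{1,|1-kx|}, which covers every t≥0 allowed by the condition; t is taken real. *)

theory Defs
  imports "HOL-Complex_Analysis.Complex_Analysis"
begin

definition kpoch :: "real \<Rightarrow> complex \<Rightarrow> nat \<Rightarrow> complex" where
  "kpoch k a n = (\<Prod>j<n. a + of_nat j * of_real k)"

text \<open>
  With \<open>z = k x\<close> the series below is the ordinary Gauss series in
  \<open>\<alpha>/k, \<beta>/k; \<gamma>/k\<close>; it converges for \<open>cmod x < 1 / k\<close>, provided that
  \<open>\<gamma>\<close> is none of \<open>0, -k, -2k, \<dots>\<close>.
\<close>
definition khyp :: "real \<Rightarrow> complex \<Rightarrow> complex \<Rightarrow> complex \<Rightarrow> complex \<Rightarrow> complex" where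
  "khyp k \<alpha> \<beta> \<gamma> x =
     (\<Sum>n. kpoch k \<alpha> n * kpoch k \<beta> n / kpoch k \<gamma> n * (x ^ n / fact n))"

end

theory Submission
  imports Defs
begin

text \<open>
  Put \<open>a = \<lambda>/k\<close>, \<open>b = \<alpha>/k\<close>, \<open>c = \<beta>/k\<close>, \<open>z = k x\<close> and \<open>s = k t\<close>. All powers of \<open>k\<close> cancel, and
  the claim becomes a statement about the Gauss series \<open>F\<close>: with
  \<open>C\<^sub>n = (a)\<^sub>n / n! F(a + n, b; c; z)\<close>, the generating function of the \<open>C\<^sub>n\<close> at \<open>s\<close> is
  \<open>G(s) = (1 - s) powr (- a) F(a, b; c; z / (1 - s))\<close>. Since \<open>(a)\<^sub>n (a + n)\<^sub>m = (a)\<^sub>n\<^sub>+\<^sub>m\<close>, both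
  sides are iterated sums of the double series with terms
  \<open>(a)\<^sub>n\<^sub>+\<^sub>m (b)\<^sub>m / ((c)\<^sub>m n! m!) z\<^sup>m s\<^sup>n\<close>: summing over \<open>m\<close> first gives the \<open>C\<^sub>n\<close>, and
  summing over \<open>n\<close> first gives binomial series.

  Absolute convergence for \<open>|z| + |s| < 1\<close> justifies the interchange there
  (\<open>gen_coeff_series_small\<close>), but \<open>s\<close> may be as negative as convergence permits. For such \<open>s\<close> the identity is continued
  analytically. \<open>G\<close> is holomorphic on the half-plane \<open>Re u < 1 - |z|\<close>, which contains the whole
  segment from \<open>0\<close> to \<open>s\<close>, and the power series is holomorphic on the open disc of radius \<open>|s|\<close>;
  the two agree near \<open>0\<close>, hence on the convex intersection. The point \<open>s\<close> itself lies on the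
  boundary of that disc, and Abel's limit theorem (\<open>power_series_tendsto_at_left_1\<close>) reaches it
  (\<open>gen_coeff_series_real\<close>).

  Convergence for \<open>|s| < min 1 |1 - z|\<close> is not visible from the double series, which need not
  converge absolutely there. It follows from a contiguous relation of Gauss, which is a three-term
  recurrence for the \<open>C\<^sub>n\<close> (\<open>gen_coeff_recurrence\<close>). Its coefficients converge, and the limiting
  characteristic polynomial has the roots \<open>1\<close> and \<open>1 / (1 - z)\<close>, so that the \<open>C\<^sub>n\<close> grow at most
  like powers of any number above \<open>max 1 (1 / |1 - z|)\<close> (\<open>summable_second_order_recurrence\<close>).
\<close>

section \<open>Abel summation and second-order recurrences\<close>

text \<open>
  Abel's limit theorem. Summation by parts writes the error at \<open>y\<close> as \<open>1 - y\<close> times the series of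
  the errors \<open>D\<close> of the partial sums. Finitely many of these are damped by the factor \<open>1 - y\<close>;
  the others are small and are averaged with the weights \<open>(1 - y) y\<^sup>n\<close>.
\<close>
lemma power_series_tendsto_at_left_1:
  fixes c :: "nat \<Rightarrow> complex"
  assumes "c sums L"
  shows "((\<lambda>y::real. \<Sum>n. c n * of_real y ^ n) \<longlongrightarrow> L) (at_left 1)"
proof -
  define D where "D n = (\<Sum>i<n. c i) - L" for n
  have D0: "D 0 = - L" by (simp add: D_def)
  have Dlim: "D \<longlonglongrightarrow> 0"
    using assms unfolding D_def sums_def by (simp add: LIM_zero)
  have c_eq: "c n = D (Suc n) - D n" for n by (simp add: D_def)
  have "Bseq D" using Dlim convergentI convergent_imp_Bseq by blast
  then obtain B where B: "\<And>n. norm (D n) \<le> B" unfolding Bseq_def by blast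
  have summ_norm: "summable (\<lambda>n. norm (D (Suc n) * of_real y ^ n))"
    if "0 \<le> y" "y < 1" for y :: real
  proof (rule summable_comparison_test[where g = "\<lambda>n. B * y ^ n"])
    show "summable (\<lambda>n. B * y ^ n)" using that by (intro summable_mult summable_geometric) auto
    show "\<exists>N. \<forall>n\<ge>N. norm (norm (D (Suc n) * of_real y ^ n)) \<le> B * y ^ n"
      using that B by (auto simp: norm_mult norm_power intro!: mult_right_mono)
  qed
  have Abel_sum: "(\<Sum>n. c n * of_real y ^ n) - L
        = (1 - of_real y) * (\<Sum>n. D (Suc n) * of_real y ^ n)"
    if "0 \<le> y" "y < 1" for y :: real
  proof -
    define h where "h = (\<Sum>n. D (Suc n) * of_real y ^ n)"
    have h: "(\<lambda>n. D (Suc n) * of_real y ^ n) sums h"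
      unfolding h_def by (rule summable_sums[OF summable_norm_cancel[OF summ_norm[OF that]]])
    have "(\<lambda>n. of_real y * (D (Suc n) * of_real y ^ n)) sums (of_real y * h)"
      by (rule sums_mult[OF h])
    then have "(\<lambda>n. D (Suc n) * of_real y ^ Suc n) sums (of_real y * h)"
      by (simp add: mult_ac)
    then have "(\<lambda>n. D n * of_real y ^ n) sums (of_real y * h + D 0 * of_real y ^ 0)"
      by (rule sums_Suc)
    from sums_diff[OF h this] have "(\<lambda>n. c n * of_real y ^ n) sums (h - (of_real y * h - L))"
      by (simp add: c_eq D0 algebra_simps)
    then show ?thesis
      by (simp add: sums_iff h_def algebra_simps)
  qed
  show ?thesis
  proof (rule tendstoI)
    fix e :: real assume "e > 0"
    then have "e / 2 > 0" by simp
    from LIMSEQ_D[OF Dlim this] obtain N where N: "\<And>n. n \<ge> N \<Longrightarrow> norm (D n) < e / 2"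
      by auto
    define K where "K = (\<Sum>n<N. norm (D (Suc n)))"
    have bound: "norm ((\<Sum>n. c n * of_real y ^ n) - L) \<le> (1 - y) * K + e / 2"
      if y: "0 \<le> y" "y < 1" for y :: real
    proof -
      have s1: "(\<lambda>n. if n \<in> {..<N} then norm (D (Suc n)) else 0) sums K"
        unfolding K_def by (rule sums_If_finite_set) simp
      have s2: "(\<lambda>n. e / 2 * y ^ n) sums (e / 2 * (1 / (1 - y)))"
        using y by (intro sums_mult geometric_sums) auto
      have "norm (\<Sum>n. D (Suc n) * of_real y ^ n) \<le> (\<Sum>n. norm (D (Suc n) * of_real y ^ n))"
        by (rule summable_norm[OF summ_norm[OF y]])
      also have "\<dots> \<le> K + e / 2 * (1 / (1 - y))"
      proof (rule sums_le[OF _ summable_sums[OF summ_norm[OF y]] sums_add[OF s1 s2]])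
        fix n
        have yn: "0 \<le> y ^ n" "y ^ n \<le> 1" using y by (auto simp: power_le_one)
        show "norm (D (Suc n) * of_real y ^ n)
            \<le> (if n \<in> {..<N} then norm (D (Suc n)) else 0) + e / 2 * y ^ n"
        proof (cases "n < N")
          case True
          have "norm (D (Suc n)) * y ^ n \<le> norm (D (Suc n))"
            using yn by (simp add: mult_left_le)
          moreover have "0 \<le> e / 2 * y ^ n" using yn \<open>e > 0\<close> by simp
          ultimately show ?thesis using True y by (simp add: norm_mult norm_power)
        next
          case False
          then have "norm (D (Suc n)) * y ^ n \<le> e / 2 * y ^ n"
            using N[of "Suc n"] yn by (intro mult_right_mono) auto
          then show ?thesis using False y by (simp add: norm_mult norm_power)
        qed
      qed
      finally have *: "norm (\<Sum>n. D (Suc n) * of_real y ^ n) \<le> K + e / 2 * (1 / (1 - y))" .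
      have "norm (1 - complex_of_real y) = 1 - y"
        using y by (metis abs_of_pos diff_gt_0_iff_gt norm_of_real of_real_1 of_real_diff)
      then have "norm ((\<Sum>n. c n * of_real y ^ n) - L)
          = (1 - y) * norm (\<Sum>n. D (Suc n) * of_real y ^ n)"
        by (simp add: Abel_sum[OF y] norm_mult)
      also have "\<dots> \<le> (1 - y) * (K + e / 2 * (1 / (1 - y)))"
        using * y by (intro mult_left_mono) auto
      also have "\<dots> = (1 - y) * K + e / 2"
        using y by (simp add: field_simps)
      finally show ?thesis .
    qed
    have "((\<lambda>y::real. (1 - y) * K + e / 2) \<longlongrightarrow> (1 - 1) * K + e / 2) (at_left 1)"
      by (intro tendsto_intros)
    then have "\<forall>\<^sub>F y in at_left 1. (1 - y) * K + e / 2 < e"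
      by (rule order_tendstoD) (use \<open>e > 0\<close> in auto)
    moreover have "\<forall>\<^sub>F y::real in at_left 1. y \<in> {0<..<1}"
      by (rule eventually_at_left_real) simp
    ultimately show "\<forall>\<^sub>F y in at_left 1. dist (\<Sum>n. c n * of_real y ^ n) L < e"
    proof eventually_elim
      case (elim y)
      then show ?case using bound[of y] by (simp add: dist_norm)
    qed
  qed
qed

text \<open>
  The upper half of Poincare's theorem on recurrences with convergent coefficients. In the
  coordinates \<open>c n\<close> and \<open>v n = c (n + 1) - \<mu> * c n\<close> the limiting recurrence is triangular with
  diagonal \<open>\<mu>, \<nu>\<close>. Weighting \<open>v\<close> by a large \<open>M\<close> makes the off-diagonal entry small, so one step
  of the actual recurrence eventually stretches the norm \<open>w\<close> by at most any given \<open>\<sigma> > \<rho>\<close>. The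
  triangular form, unlike a diagonal one, also covers a double root \<open>\<mu> = \<nu>\<close>.
\<close>
lemma summable_second_order_recurrence:
  fixes c P Q :: "nat \<Rightarrow> complex" and \<mu> \<nu> s :: complex
  assumes rec: "\<And>n. c (n + 2) = P n * c (n + 1) - Q n * c n"
    and P: "P \<longlonglongrightarrow> \<mu> + \<nu>" and Q: "Q \<longlonglongrightarrow> \<mu> * \<nu>"
    and s: "norm s * max (norm \<mu>) (norm \<nu>) < 1"
  shows "summable (\<lambda>n. c n * s ^ n)"
proof -
  define \<rho> where "\<rho> = max (norm \<mu>) (norm \<nu>)"
  have rho0: "\<rho> \<ge> 0" by (simp add: \<rho>_def le_max_iff_disj)
  have mu: "norm \<mu> \<le> \<rho>" and nu: "norm \<nu> \<le> \<rho>" by (auto simp: \<rho>_def)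
  obtain \<sigma> where sigma: "\<sigma> > \<rho>" "norm s * \<sigma> < 1"
  proof (cases "s = 0")
    case True
    then show ?thesis using that[of "\<rho> + 1"] by simp
  next
    case False
    then have "\<rho> < 1 / norm s"
      using s by (simp add: \<rho>_def less_divide_eq mult.commute del: max_less_iff_conj)
    then obtain \<sigma> where "\<rho> < \<sigma>" "\<sigma> < 1 / norm s" using dense by blast
    then show ?thesis using that[of \<sigma>] False by (simp add: field_simps)
  qed
  define \<delta> where "\<delta> = \<sigma> - \<rho>"
  \<comment> \<open>The slack \<open>\<delta>\<close> has to absorb \<open>1 / M + e\<close> in the coefficient of \<open>M * norm (v n)\<close>, half for
    each summand, and \<open>M * e * (\<rho> + 1)\<close> in the coefficient of \<open>norm (c n)\<close>.\<close>
  define M where "M = 2 / \<delta>"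
  define e where "e = min (\<delta> / 2) (\<delta> / (M * (\<rho> + 1)))"
  have d0: "\<delta> > 0" using sigma by (simp add: \<delta>_def)
  then have M0: "M > 0" by (simp add: M_def)
  have e0: "e > 0" using d0 M0 rho0 by (simp add: e_def)
  have e1: "e \<le> \<delta> / 2" and e2: "M * e * (\<rho> + 1) \<le> \<delta>"
  proof -
    show "e \<le> \<delta> / 2" unfolding e_def by (rule min.cobounded1)
    have "e \<le> \<delta> / (M * (\<rho> + 1))" unfolding e_def by (rule min.cobounded2)
    then have "e * (M * (\<rho> + 1)) \<le> \<delta>" using M0 rho0 by (subst (asm) pos_le_divide_eq) auto
    then show "M * e * (\<rho> + 1) \<le> \<delta>" by (simp only: mult_ac)
  qed
  define v where "v n = c (n + 1) - \<mu> * c n" for n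
  define w where "w n = norm (c n) + M * norm (v n)" for n
  have w0: "w n \<ge> 0" for n using M0 by (simp add: w_def)
  from LIMSEQ_D[OF P e0] obtain N1 where N1: "\<And>n. n \<ge> N1 \<Longrightarrow> norm (P n - (\<mu> + \<nu>)) < e" by auto
  from LIMSEQ_D[OF Q e0] obtain N2 where N2: "\<And>n. n \<ge> N2 \<Longrightarrow> norm (Q n - \<mu> * \<nu>) < e" by auto
  have step: "w (Suc n) \<le> \<sigma> * w n" if n: "n \<ge> max N1 N2" for n
  proof -
    have "norm (\<mu> * c n + v n) \<le> norm \<mu> * norm (c n) + norm (v n)"
      by (metis norm_mult norm_triangle_ineq)
    also have "\<dots> \<le> \<rho> * norm (c n) + norm (v n)"
      using mu by (simp add: mult_right_mono)
    finally have c1: "norm (c (Suc n)) \<le> \<rho> * norm (c n) + norm (v n)"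
      by (simp add: v_def)
    have "v (Suc n) = \<nu> * v n + ((P n - (\<mu> + \<nu>)) * c (Suc n) - (Q n - \<mu> * \<nu>) * c n)"
      using rec[of n] by (simp add: v_def algebra_simps)
    then have "norm (v (Suc n))
        \<le> norm \<nu> * norm (v n)
          + (norm (P n - (\<mu> + \<nu>)) * norm (c (Suc n)) + norm (Q n - \<mu> * \<nu>) * norm (c n))"
      by (metis (no_types, lifting) add_left_mono norm_mult norm_triangle_ineq
          norm_triangle_ineq4 order_trans)
    also have "\<dots> \<le> \<rho> * norm (v n) + (e * norm (c (Suc n)) + e * norm (c n))"
      using nu N1[of n] N2[of n] n by (intro add_mono mult_right_mono) auto
    also have "\<dots> \<le> \<rho> * norm (v n) + (e * (\<rho> * norm (c n) + norm (v n)) + e * norm (c n))"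
      using c1 e0 by simp
    finally have v1: "norm (v (Suc n))
        \<le> \<rho> * norm (v n) + e * norm (v n) + e * (\<rho> + 1) * norm (c n)"
      by (simp add: algebra_simps)
    have "w (Suc n) \<le> (\<rho> * norm (c n) + norm (v n))
        + M * (\<rho> * norm (v n) + e * norm (v n) + e * (\<rho> + 1) * norm (c n))"
      unfolding w_def using c1 v1 M0 by (intro add_mono mult_left_mono) auto
    also have "\<dots> = (\<rho> + M * e * (\<rho> + 1)) * norm (c n)
        + (1 + M * \<rho> + M * e) * norm (v n)"
      by (simp add: algebra_simps)
    also have "\<dots> \<le> \<sigma> * norm (c n) + (M * \<sigma>) * norm (v n)"
    proof (intro add_mono mult_right_mono)
      show "\<rho> + M * e * (\<rho> + 1) \<le> \<sigma>" using e2 by (simp add: \<delta>_def)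
      have "M * e \<le> M * (\<delta> / 2)" using e1 M0 by simp
      moreover have "M * (\<delta> / 2) = 1" "M * \<delta> = 2" using d0 by (simp_all add: M_def)
      moreover have "M * \<sigma> = M * \<rho> + M * \<delta>" by (simp add: \<delta>_def algebra_simps)
      ultimately show "1 + M * \<rho> + M * e \<le> M * \<sigma>" by linarith
    qed auto
    also have "\<dots> = \<sigma> * w n" by (simp add: w_def algebra_simps)
    finally show ?thesis .
  qed
  have "summable (\<lambda>n. w n * norm s ^ n)"
  proof (rule summable_ratio_test[where c = "norm s * \<sigma>" and N = "max N1 N2"])
    show "norm s * \<sigma> < 1" by (rule sigma)
    fix n assume n: "n \<ge> max N1 N2"
    have "w (Suc n) * norm s ^ Suc n \<le> (\<sigma> * w n) * norm s ^ Suc n"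
      using step[OF n] by (intro mult_right_mono) auto
    then show "norm (w (Suc n) * norm s ^ Suc n) \<le> norm s * \<sigma> * norm (w n * norm s ^ n)"
      using w0 by (simp add: mult_ac)
  qed
  then show ?thesis
  proof (rule summable_comparison_test[rotated])
    have "norm (c n) \<le> w n" for n using M0 by (simp add: w_def)
    then show "\<exists>N. \<forall>n\<ge>N. norm (c n * s ^ n) \<le> w n * norm s ^ n"
      by (auto simp: norm_mult norm_power intro!: mult_right_mono)
  qed
qed

section \<open>The Gauss series\<close>

text \<open>
  Where \<open>(c)\<^sub>m\<close> vanishes the coefficient is \<open>0\<close>. This default value is compatible with the
  recursion \<open>gauss_coeff_Suc\<close>, on which the ratio test rests.
\<close>
definition gauss_coeff :: "complex \<Rightarrow> complex \<Rightarrow> complex \<Rightarrow> nat \<Rightarrow> complex" where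
  "gauss_coeff a b c m = pochhammer a m * pochhammer b m / (pochhammer c m * fact m)"

definition gauss :: "complex \<Rightarrow> complex \<Rightarrow> complex \<Rightarrow> complex \<Rightarrow> complex" where
  "gauss a b c z = (\<Sum>m. gauss_coeff a b c m * z ^ m)"

lemma kpoch_eq_pochhammer:
  assumes "k \<noteq> 0"
  shows "kpoch k a n = of_real k ^ n * pochhammer (a / of_real k) n"
proof -
  have "kpoch k a n = (\<Prod>j<n. of_real k * (a / of_real k + of_nat j))"
    unfolding kpoch_def using assms by (intro prod.cong) (auto simp: field_simps)
  then show ?thesis
    by (simp add: prod.distrib pochhammer_prod atLeast0LessThan)
qed

lemma khyp_eq_gauss:
  assumes "k \<noteq> 0"
  shows "khyp k l \<alpha> \<beta> x
    = gauss (l / of_real k) (\<alpha> / of_real k) (\<beta> / of_real k) (of_real k * x)"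
  unfolding khyp_def gauss_def gauss_coeff_def
  using assms by (simp add: kpoch_eq_pochhammer power_mult_distrib field_simps)

lemma gauss_coeff_Suc:
  "gauss_coeff a b c (Suc m)
    = (a + of_nat m) * (b + of_nat m) / ((c + of_nat m) * of_nat (Suc m)) * gauss_coeff a b c m"
  by (simp add: gauss_coeff_def pochhammer_Suc field_simps)

lemma tendsto_affine_ratio_1:
  fixes a c :: complex
  shows "(\<lambda>m. (a + of_nat m) / (c + of_nat m)) \<longlonglongrightarrow> 1"
proof -
  have inv: "(\<lambda>m. 1 / of_nat m :: complex) \<longlonglongrightarrow> 0"
    by (rule lim_1_over_n)
  have "(\<lambda>m. (a * (1 / of_nat m) + 1) / (c * (1 / of_nat m) + 1)) \<longlonglongrightarrow> (a * 0 + 1) / (c * 0 + 1)"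
    by (intro tendsto_intros inv) auto
  moreover have "\<forall>\<^sub>F m in sequentially. (a * (1 / of_nat m) + 1) / (c * (1 / of_nat m) + 1)
      = (a + of_nat m) / (c + of_nat m)"
    using eventually_gt_at_top[of 0]
  proof eventually_elim
    case (elim m)
    then have "(a + of_nat m) / (c + of_nat m)
        = ((a + of_nat m) / of_nat m) / ((c + of_nat m) / of_nat m)" by simp
    then show ?case using elim by (simp add: add_divide_distrib)
  qed
  ultimately show ?thesis by (simp add: tendsto_cong)
qed

lemma summable_norm_gauss:
  assumes "norm z < 1"
  shows "summable (\<lambda>m. norm (gauss_coeff a b c m * z ^ m))"
proof -
  obtain r where r: "norm z < r" "r < 1" using dense assms by blast
  define q where "q m = (a + of_nat m) / (c + of_nat m) * ((b + of_nat m) / (1 + of_nat m)) * z" for m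
  have "q \<longlonglongrightarrow> 1 * 1 * z"
    unfolding q_def by (intro tendsto_intros tendsto_affine_ratio_1)
  then have "(\<lambda>m. norm (q m)) \<longlonglongrightarrow> norm z" by (simp add: tendsto_norm)
  then have "\<forall>\<^sub>F m in sequentially. norm (q m) < r" using r by (intro order_tendstoD) auto
  then obtain N where N: "\<And>m. m \<ge> N \<Longrightarrow> norm (q m) < r" by (auto simp: eventually_at_top_linorder)
  show ?thesis
  proof (rule summable_ratio_test[where c = r and N = N])
    fix m assume "m \<ge> N"
    have "gauss_coeff a b c (Suc m) * z ^ Suc m = q m * (gauss_coeff a b c m * z ^ m)"
      by (simp add: gauss_coeff_Suc q_def)
    then have "norm (gauss_coeff a b c (Suc m) * z ^ Suc m)
        = norm (q m) * norm (gauss_coeff a b c m * z ^ m)" by (metis norm_mult)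
    also have "\<dots> \<le> r * norm (gauss_coeff a b c m * z ^ m)"
      using N[OF \<open>m \<ge> N\<close>] by (intro mult_right_mono) auto
    finally show "norm (norm (gauss_coeff a b c (Suc m) * z ^ Suc m))
        \<le> r * norm (norm (gauss_coeff a b c m * z ^ m))" by simp
  qed (use r in auto)
qed

lemma gauss_sums:
  assumes "norm z < 1"
  shows "(\<lambda>m. gauss_coeff a b c m * z ^ m) sums gauss a b c z"
  unfolding gauss_def
  by (rule summable_sums[OF summable_norm_cancel[OF summable_norm_gauss[OF assms]]])

lemma gauss_holomorphic: "gauss a b c holomorphic_on ball 0 1"
  by (rule power_series_holomorphic[where a = "gauss_coeff a b c"]) (auto intro: gauss_sums)

lemma binomial_series:
  fixes a s :: complex
  assumes "norm s < 1"
  shows "(\<lambda>n. pochhammer a n / fact n * s ^ n) sums (1 - s) powr (- a)"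
proof -
  have "(\<lambda>n. (- a gchoose n) * (- s) ^ n) sums (1 + - s) powr (- a)"
    using assms by (intro gen_binomial_complex) auto
  moreover have "(- a gchoose n) * (- s) ^ n = pochhammer a n / fact n * s ^ n" for n
    by (simp add: gbinomial_pochhammer power_mult_distrib[symmetric] mult_ac)
  ultimately show ?thesis by simp
qed

section \<open>The coefficients of the generating function\<close>

text \<open>
  The coefficients \<open>C\<^sub>n\<close> of the generating function, and the terms of the double series without
  the factor \<open>s\<^sup>n\<close>, where \<open>n\<close> counts powers of \<open>s\<close> and \<open>m\<close> counts powers of \<open>z\<close>.
\<close>
definition gen_coeff :: "complex \<Rightarrow> complex \<Rightarrow> complex \<Rightarrow> complex \<Rightarrow> nat \<Rightarrow> complex" where
  "gen_coeff a b c z n = pochhammer a n / fact n * gauss (a + of_nat n) b c z"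

definition gen_term :: "complex \<Rightarrow> complex \<Rightarrow> complex \<Rightarrow> complex \<Rightarrow> nat \<Rightarrow> nat \<Rightarrow> complex" where
  "gen_term a b c z n m = pochhammer a (n + m) * pochhammer b m
     / (fact n * fact m * pochhammer c m) * z ^ m"

lemma gen_term_eq:
  "gen_term a b c z n m
    = pochhammer a n / fact n * (gauss_coeff (a + of_nat n) b c m * z ^ m)"
  by (simp add: gen_term_def gauss_coeff_def pochhammer_product' mult_ac)

lemma gen_term_sums:
  assumes "norm z < 1"
  shows "gen_term a b c z n sums gen_coeff a b c z n"
  unfolding gen_term_eq[abs_def] gen_coeff_def by (intro sums_mult gauss_sums assms)

lemma gen_term_Suc_left:
  "of_nat (Suc n) * gen_term a b c z (Suc n) m = (a + of_nat n + of_nat m) * gen_term a b c z n m"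
proof -
  have nz: "of_nat (Suc n) \<noteq> (0 :: complex)" by (simp only: of_nat_eq_0_iff)
  have cancel: "w * (A * y * B / (w * F * G * H) * Z) = y * (A * B / (F * G * H) * Z)"
    if "w \<noteq> 0" for w A B y F G H Z :: complex
    using that by (cases "F * G * H = 0") (auto simp: field_simps)
  have "of_nat (Suc n) * gen_term a b c z (Suc n) m
      = of_nat (Suc n) * (pochhammer a (n + m) * (a + of_nat (n + m)) * pochhammer b m
        / (of_nat (Suc n) * fact n * fact m * pochhammer c m) * z ^ m)"
    by (simp only: gen_term_def add_Suc pochhammer_Suc[of a] fact_Suc[of n])
  also have "\<dots> = (a + of_nat (n + m)) * gen_term a b c z n m"
    unfolding gen_term_def by (rule cancel[OF nz])
  finally show ?thesis by (simp only: of_nat_add add.assoc)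
qed

lemma gen_term_Suc_right:
  assumes "c + of_nat m \<noteq> 0"
  shows "of_nat (Suc m) * (c + of_nat m) * gen_term a b c z n (Suc m)
    = z * (b + of_nat m) * (a + of_nat n + of_nat m) * gen_term a b c z n m"
proof -
  have nz: "of_nat (Suc m) \<noteq> (0 :: complex)" by (simp only: of_nat_eq_0_iff)
  have cancel: "w * v * (A * x * (B * y) / (F * (w * G) * (H * v)) * (z * Z))
        = z * y * x * (A * B / (F * G * H) * Z)"
    if "w \<noteq> 0" "v \<noteq> 0" for w v A B x y F G H Z :: complex
    using that by (cases "F * G * H = 0") (auto simp: field_simps)
  have "of_nat (Suc m) * (c + of_nat m) * gen_term a b c z n (Suc m)
      = of_nat (Suc m) * (c + of_nat m)
        * (pochhammer a (n + m) * (a + of_nat (n + m)) * (pochhammer b m * (b + of_nat m))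
          / (fact n * (of_nat (Suc m) * fact m) * (pochhammer c m * (c + of_nat m)))
          * (z * z ^ m))"
    by (simp only: gen_term_def add_Suc_right pochhammer_Suc fact_Suc[of m] power_Suc)
  also have "\<dots> = z * (b + of_nat m) * (a + of_nat (n + m)) * gen_term a b c z n m"
    unfolding gen_term_def by (rule cancel[OF nz assms])
  finally show ?thesis by (simp only: of_nat_add add.assoc)
qed

text \<open>
  This is Gauss's contiguous relation between \<open>F(a + n)\<close>, \<open>F(a + n + 1)\<close> and \<open>F(a + n + 2)\<close>,
  with the factors \<open>(a)\<^sub>n / n!\<close> absorbed so that it also holds where \<open>a + n\<close> vanishes. The terms on the
  left with fixed \<open>m\<close> do not cancel, but they are a difference \<open>U (m + 1) - U m\<close> with \<open>U 0 = 0\<close>.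
  That \<open>U\<close> tends to \<open>0\<close> is seen by writing \<open>U (m + 1)\<close> as a combination, with coefficients free of
  \<open>m\<close>, of terms of the convergent series for \<open>C\<^sub>n\<^sub>+\<^sub>2\<close> and \<open>C\<^sub>n\<^sub>+\<^sub>1\<close>.
\<close>
lemma gen_coeff_recurrence:
  assumes z: "norm z < 1" and c: "\<And>j. c + of_nat j \<noteq> 0"
  shows "of_nat (n + 2) * (z - 1) * gen_coeff a b c z (n + 2)
     + (2 * (a + of_nat n + 1) - c + (b - a - of_nat n - 1) * z) * gen_coeff a b c z (n + 1)
     - (a + of_nat n + 1 - c) * (a + of_nat n) / of_nat (n + 1) * gen_coeff a b c z n = 0"
    (is "?A * _ + ?B * _ - ?C * _ = 0")
proof -
  define T where "T = gen_term a b c z"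
  define p where "p m = T n m / of_nat (n + 1)" for m
  define U where "U m = of_nat m * (c + of_nat m - 1) * p m" for m
  have n1: "of_nat (n + 1) \<noteq> (0 :: complex)" by (simp only: of_nat_eq_0_iff)
  have T: "T j sums gen_coeff a b c z j" for j
    unfolding T_def by (rule gen_term_sums[OF z])
  have T0: "T n m = of_nat (n + 1) * p m" for m
    using n1 by (simp add: p_def del: of_nat_add of_nat_Suc)
  have T1: "T (n + 1) m = (a + of_nat n + of_nat m) * p m" for m
  proof -
    have "of_nat (n + 1) * T (n + 1) m = (a + of_nat n + of_nat m) * T n m"
      using gen_term_Suc_left[of n a b c z m] by (simp only: T_def Suc_eq_plus1)
    then show ?thesis using n1 unfolding T0 by (simp add: mult.left_commute del: of_nat_add of_nat_Suc)
  qed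
  have T2: "of_nat (n + 2) * T (n + 2) m = (a + of_nat n + of_nat m + 1) * T (n + 1) m" for m
  proof -
    have "Suc (n + 1) = n + 2" by simp
    then show ?thesis
      using gen_term_Suc_left[of "n + 1" a b c z m] unfolding T_def by (simp add: add_ac)
  qed
  have U_Suc: "U (Suc m) = z * (b + of_nat m) * T (n + 1) m" for m
  proof -
    have "U (Suc m) = (of_nat (Suc m) * (c + of_nat m) * T n (Suc m)) / of_nat (n + 1)"
      by (simp add: U_def p_def)
    also have "\<dots> = z * (b + of_nat m) * ((a + of_nat n + of_nat m) * p m)"
      unfolding T_def gen_term_Suc_right[OF c] by (simp add: p_def T_def mult.assoc)
    finally show ?thesis by (simp only: T1)
  qed
  have U_Suc': "U (Suc m) = z * (of_nat (n + 2) * T (n + 2) m + (b - a - of_nat n - 1) * T (n + 1) m)"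
    for m
    unfolding U_Suc T2 by (simp add: algebra_simps)
  have Tlim: "T j \<longlonglongrightarrow> 0" for j using T[of j] by (intro summable_LIMSEQ_zero) (auto simp: sums_iff)
  have "(\<lambda>m. U (Suc m)) \<longlonglongrightarrow> z * (of_nat (n + 2) * 0 + (b - a - of_nat n - 1) * 0)"
    unfolding U_Suc' by (intro tendsto_intros Tlim)
  then have "U \<longlonglongrightarrow> 0" by (simp add: filterlim_sequentially_Suc)
  from telescope_sums[OF this] have tele: "(\<lambda>m. U (Suc m) - U m) sums 0" by (simp add: U_def)
  have E: "?A * T (n + 2) m + ?B * T (n + 1) m - ?C * T n m = U (Suc m) - U m" for m
  proof -
    define y where "y = a + of_nat n"
    have "?C * T n m = (y + 1 - c) * y * p m"
      using n1 by (simp add: p_def y_def del: of_nat_add of_nat_Suc)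
    moreover have "?A * T (n + 2) m = (z - 1) * (of_nat (n + 2) * T (n + 2) m)"
      by (simp only: mult_ac)
    then have "?A * T (n + 2) m = (z - 1) * ((y + of_nat m + 1) * ((y + of_nat m) * p m))"
      by (simp only: T2 T1 y_def)
    moreover have "T (n + 1) m = (y + of_nat m) * p m" by (simp only: T1 y_def)
    \<comment> \<open>A polynomial identity once \<open>p m\<close>, the common factor of all terms, is split off.\<close>
    moreover have "(z - 1) * ((y + of_nat m + 1) * ((y + of_nat m) * p m))
        + (2 * (y + 1) - c + (b - y - 1) * z) * ((y + of_nat m) * p m) - (y + 1 - c) * y * p m
        = z * (b + of_nat m) * ((y + of_nat m) * p m) - of_nat m * (c + of_nat m - 1) * p m"
      by algebra
    ultimately show ?thesis
      unfolding U_Suc U_def[of m] by (simp only: y_def diff_diff_eq)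
  qed
  have "(\<lambda>m. ?A * T (n + 2) m + ?B * T (n + 1) m - ?C * T n m) sums
      (?A * gen_coeff a b c z (n + 2) + ?B * gen_coeff a b c z (n + 1) - ?C * gen_coeff a b c z n)"
    by (intro sums_add sums_diff sums_mult T)
  with tele show ?thesis unfolding E by (rule sums_unique2[symmetric])
qed

lemma summable_gen_coeff:
  assumes z: "norm z < 1" and c: "\<And>j. c + of_nat j \<noteq> 0"
    and s: "norm s < min 1 (norm (1 - z))"
  shows "summable (\<lambda>n. gen_coeff a b c z n * s ^ n)"
proof -
  have z1: "1 - z \<noteq> 0" using z by auto
  define P where "P n = (2 * (a + of_nat n + 1) - c + (b - a - of_nat n - 1) * z)
    / of_nat (n + 2) / (1 - z)" for n
  define Q where "Q n = (a + of_nat n + 1 - c) * (a + of_nat n) / of_nat (n + 1)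
    / of_nat (n + 2) / (1 - z)" for n
  show ?thesis
  proof (rule summable_second_order_recurrence[where \<mu> = 1 and \<nu> = "1 / (1 - z)"])
    fix n
    define x2 x1 x0 where "x2 = gen_coeff a b c z (n + 2)"
      and "x1 = gen_coeff a b c z (n + 1)" and "x0 = gen_coeff a b c z n"
    define N B C where "N = complex_of_nat (n + 2)"
      and "B = 2 * (a + of_nat n + 1) - c + (b - a - of_nat n - 1) * z"
      and "C = (a + of_nat n + 1 - c) * (a + of_nat n) / of_nat (n + 1)"
    have "N \<noteq> 0" unfolding N_def by (simp only: of_nat_eq_0_iff)
    have "N * (z - 1) * x2 + B * x1 - C * x0 = 0"
      using gen_coeff_recurrence[OF z c, of n a b]
      unfolding x2_def x1_def x0_def N_def B_def C_def .
    then have "(N * (1 - z)) * x2 = B * x1 - C * x0" by (simp add: algebra_simps)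
    then have "x2 = (B * x1 - C * x0) / (N * (1 - z))"
      using \<open>N \<noteq> 0\<close> z1 by (simp add: eq_divide_eq mult_ac)
    also have "\<dots> = B / N / (1 - z) * x1 - C / N / (1 - z) * x0"
      by (simp add: diff_divide_distrib)
    finally show "gen_coeff a b c z (n + 2) = P n * gen_coeff a b c z (n + 1) - Q n * gen_coeff a b c z n"
      unfolding x2_def x1_def x0_def N_def B_def C_def P_def Q_def .
  next
    have "P = (\<lambda>n. (2 * (((a + 1 - c / 2) + of_nat n) / (2 + of_nat n))
        - z * (((a + 1 - b) + of_nat n) / (2 + of_nat n))) / (1 - z))"
      unfolding P_def times_divide_eq_right diff_divide_distrib[symmetric]
      by (rule ext) (simp add: algebra_simps)
    moreover have "(\<lambda>n. (2 * (((a + 1 - c / 2) + of_nat n) / (2 + of_nat n))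
        - z * (((a + 1 - b) + of_nat n) / (2 + of_nat n))) / (1 - z)) \<longlonglongrightarrow> (2 * 1 - z * 1) / (1 - z)"
      by (intro tendsto_intros tendsto_affine_ratio_1 z1)
    moreover have "(2 * 1 - z * 1) / (1 - z) = 1 + 1 / (1 - z)" using z1 by (simp add: field_simps)
    ultimately show "P \<longlonglongrightarrow> 1 + 1 / (1 - z)" by simp
  next
    have "Q = (\<lambda>n. ((a + 1 - c) + of_nat n) / (1 + of_nat n) * ((a + of_nat n) / (2 + of_nat n)) / (1 - z))"
      by (rule ext) (simp add: Q_def algebra_simps)
    moreover have "(\<lambda>n. ((a + 1 - c) + of_nat n) / (1 + of_nat n) * ((a + of_nat n) / (2 + of_nat n)) / (1 - z))
      \<longlonglongrightarrow> 1 * 1 / (1 - z)"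
      by (intro tendsto_intros tendsto_affine_ratio_1 z1)
    ultimately show "Q \<longlonglongrightarrow> 1 * (1 / (1 - z))" by simp
  next
    show "norm s * max (norm (1 :: complex)) (norm (1 / (1 - z))) < 1"
      using s z1 by (auto simp: max_def norm_divide field_simps)
  qed
qed

section \<open>The double series\<close>

lemma norm_pochhammer_le: "norm (pochhammer (a::complex) n) \<le> pochhammer (norm a) n"
proof (induction n)
  case (Suc n)
  have "norm (a + of_nat n) \<le> norm a + of_nat n"
    using norm_triangle_ineq[of a "of_nat n"] by simp
  then show ?case using Suc.IH order_trans[OF norm_ge_zero Suc.IH]
    by (simp add: pochhammer_Suc norm_mult mult_mono)
qed simp

lemma gen_term_column_sums:
  assumes s: "norm s < 1"
  shows "(\<lambda>n. gen_term a b c z n m * s ^ n) sums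
    ((1 - s) powr (- a) * (gauss_coeff a b c m * (z / (1 - s)) ^ m))"
proof -
  have s1: "1 - s \<noteq> 0" using s by auto
  have "(\<lambda>n. gauss_coeff a b c m * z ^ m * (pochhammer (a + of_nat m) n / fact n * s ^ n)) sums
      (gauss_coeff a b c m * z ^ m * (1 - s) powr (- (a + of_nat m)))"
    by (intro sums_mult binomial_series s)
  moreover have "gauss_coeff a b c m * z ^ m * (pochhammer (a + of_nat m) n / fact n * s ^ n)
      = gen_term a b c z n m * s ^ n" for n
    by (simp add: gen_term_def gauss_coeff_def add.commute[of n m] pochhammer_product' mult_ac)
  moreover have "(1 - s) powr (- (a + of_nat m)) = (1 - s) powr (- a) / (1 - s) ^ m"
    using s1 by (simp add: powr_diff powr_nat' minus_add)
  ultimately show ?thesis by (simp add: power_divide mult_ac)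
qed

text \<open>
  The moduli are dominated by the same terms with \<open>a\<close> and \<open>s\<close> replaced by their moduli \<open>A\<close> and
  \<open>S\<close>. For fixed \<open>m\<close> these are, up to a factor \<open>d\<close> without \<open>n\<close>, nonnegative, so the sum of their moduli
  is the modulus of the binomial sum \<open>W m\<close>. The \<open>W m\<close> are the terms of a Gauss series at
  \<open>z / (1 - S)\<close>, which lies in the unit disc exactly because \<open>|z| + |s| < 1\<close>.
\<close>
lemma gen_term_abs_summable:
  assumes "norm z + norm s < 1"
  shows "(\<lambda>p. norm (case p of (m, n) \<Rightarrow> gen_term a b c z n m * s ^ n)) summable_on (UNIV \<times> UNIV)"
proof -
  define A where "A = complex_of_real (norm a)"
  define S where "S = complex_of_real (norm s)"
  have "norm s < 1" using assms norm_ge_zero[of z] by linarith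
  then have s1: "norm S < 1" by (simp add: S_def)
  have zs: "norm (z / (1 - S)) < 1"
  proof -
    have "norm (1 - S) = 1 - norm s"
      using s1 unfolding S_def by (metis abs_of_pos diff_gt_0_iff_gt norm_of_real of_real_1 of_real_diff abs_norm_cancel)
    then show ?thesis using assms s1 by (simp add: norm_divide S_def)
  qed
  define W where "W m = (1 - S) powr (- A) * (gauss_coeff A b c m * (z / (1 - S)) ^ m)" for m
  define g where "g m n = norm (gen_term A b c z n m * S ^ n)" for m n
  have poch0: "0 \<le> pochhammer (norm a) j" for j
    by (rule order_trans[OF norm_ge_zero norm_pochhammer_le])
  have A_poch: "norm (pochhammer A j) = pochhammer (norm a) j" for j
    using poch0 unfolding A_def pochhammer_of_real norm_of_real by simp
  have g_sums: "g m sums norm (W m)" for m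
  proof -
    define d where "d = pochhammer b m / (fact m * pochhammer c m) * z ^ m"
    have eq: "gen_term A b c z n m * S ^ n = of_real (pochhammer (norm a) (n + m) / fact n * norm s ^ n) * d" for n
      by (simp add: gen_term_def d_def A_def S_def pochhammer_of_real mult_ac)
    define r where "r n = pochhammer (norm a) (n + m) / fact n * norm s ^ n" for n
    have r0: "r n \<ge> 0" for n using poch0 by (simp add: r_def)
    have W: "(\<lambda>n. of_real (r n) * d) sums W m"
      using gen_term_column_sums[OF s1, of A b c z m] unfolding eq W_def r_def .
    show ?thesis
    proof (cases "d = 0")
      case True
      then show ?thesis using W unfolding g_def eq by (simp add: sums_iff)
    next
      case False
      have "(\<lambda>n. of_real (r n) * d / d) sums (W m / d)" by (rule sums_divide[OF W])
      then have "(\<lambda>n. complex_of_real (r n)) sums (W m / d)" using False by simp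
      then have r: "r sums Re (W m / d)" and "W m / d = of_real (Re (W m / d))"
        by (auto simp: sums_complex_iff complex_eq_iff sums_iff)
      then have "norm (W m) = \<bar>Re (W m / d)\<bar> * norm d"
        using False by (metis nonzero_eq_divide_eq norm_mult norm_of_real)
      moreover have "0 \<le> Re (W m / d)" using r r0 by (metis sums_le sums_zero)
      ultimately have "norm (W m) = Re (W m / d) * norm d" by simp
      moreover have "(\<lambda>n. r n * norm d) sums (Re (W m / d) * norm d)" by (rule sums_mult2[OF r])
      moreover have "g m = (\<lambda>n. r n * norm d)"
        using r0 unfolding g_def eq r_def[symmetric] by (simp add: norm_mult)
      ultimately show ?thesis by simp
    qed
  qed
  have g0: "g m n \<ge> 0" for m n by (simp add: g_def)
  have le: "norm (gen_term a b c z n m * s ^ n) \<le> g m n" for m n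
    using norm_pochhammer_le[of a "n + m"]
    by (auto simp: g_def gen_term_def norm_mult norm_divide norm_power A_poch S_def
        intro!: mult_right_mono divide_right_mono)
  have g_has: "(g m has_sum norm (W m)) UNIV" for m
    by (rule sums_nonneg_imp_has_sum[OF g_sums g0])
  have "(\<lambda>p. norm (case p of (m, n) \<Rightarrow> g m n)) summable_on (UNIV \<times> UNIV)"
    unfolding Infinite_Sum.abs_summable_on_Sigma_iff
  proof (intro conjI ballI)
    fix m
    show "(\<lambda>n. norm (case (m, n) of (m, n) \<Rightarrow> g m n)) summable_on UNIV"
      using g_has[of m] g0 by (auto simp: summable_on_def)
    have "summable (\<lambda>m. norm (W m))"
      unfolding W_def norm_mult[of "(1 - S) powr (- A)"]
      by (intro summable_mult summable_norm_gauss zs)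
    then have "(\<lambda>m. norm (W m)) summable_on UNIV"
      by (intro summable_nonneg_imp_summable_on) auto
    moreover have "(\<Sum>\<^sub>\<infinity>n. norm (case (m, n) of (m, n) \<Rightarrow> g m n)) = norm (W m)" for m
      using infsumI[OF g_has[of m]] g0 by simp
    ultimately show "(\<lambda>m. norm (\<Sum>\<^sub>\<infinity>n. norm (case (m, n) of (m, n) \<Rightarrow> g m n))) summable_on UNIV"
      by simp
  qed
  then show ?thesis
    by (rule Infinite_Sum.abs_summable_on_comparison_test) (use le g0 in \<open>auto simp: abs_of_nonneg\<close>)
qed

lemma gen_coeff_series_small:
  assumes zs: "norm z + norm s < 1"
  shows "(\<Sum>n. gen_coeff a b c z n * s ^ n) = (1 - s) powr (- a) * gauss a b c (z / (1 - s))"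
proof -
  have z: "norm z < 1" and s: "norm s < 1"
    using zs norm_ge_zero[of z] norm_ge_zero[of s] by linarith+
  have w: "norm (z / (1 - s)) < 1"
  proof -
    have "1 - norm s \<le> norm (1 - s)" using norm_triangle_ineq2[of 1 s] by simp
    then have "norm z < norm (1 - s)" using zs by linarith
    then show ?thesis by (simp add: norm_divide divide_less_eq)
  qed
  define f where "f = (\<lambda>m n. gen_term a b c z n m * s ^ n)"
  have abs: "(\<lambda>p. norm (case p of (m, n) \<Rightarrow> f m n)) summable_on (UNIV \<times> UNIV)"
    unfolding f_def by (rule gen_term_abs_summable[OF zs])
  then have "(\<lambda>(m, n). f m n) summable_on (UNIV \<times> UNIV)" by (rule abs_summable_summable)
  then obtain X where X: "((\<lambda>(m, n). f m n) has_sum X) (UNIV \<times> UNIV)"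
    unfolding summable_on_def by blast
  have rows: "((\<lambda>n. f m n) has_sum ((1 - s) powr (- a) * (gauss_coeff a b c m * (z / (1 - s)) ^ m))) UNIV" for m
  proof (rule norm_summable_imp_has_sum)
    have "(\<lambda>n. norm (f m n)) summable_on UNIV"
      using abs unfolding Infinite_Sum.abs_summable_on_Sigma_iff by auto
    then show "summable (\<lambda>n. norm (f m n))" by (rule summable_on_imp_summable)
  qed (unfold f_def, rule gen_term_column_sums[OF s])
  have cols: "((\<lambda>m. f m n) has_sum (gen_coeff a b c z n * s ^ n)) UNIV" for n
  proof (rule norm_summable_imp_has_sum)
    show "(\<lambda>m. f m n) sums (gen_coeff a b c z n * s ^ n)"
      unfolding f_def by (intro sums_mult2 gen_term_sums z)
    have "summable (\<lambda>m. norm (pochhammer a n / fact n) *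
       norm (gauss_coeff (a + of_nat n) b c m * z ^ m) * norm (s ^ n))"
      by (intro summable_mult summable_mult2 summable_norm_gauss z)
    then show "summable (\<lambda>m. norm (f m n))"
      by (simp only: f_def gen_term_eq norm_mult)
  qed
  have "((\<lambda>m. (1 - s) powr (- a) * (gauss_coeff a b c m * (z / (1 - s)) ^ m)) has_sum X) UNIV"
    by (rule has_sum_SigmaD[OF X]) (simp add: rows)
  then have "X = (1 - s) powr (- a) * gauss a b c (z / (1 - s))"
    using sums_mult[OF gauss_sums[OF w], of "(1 - s) powr (- a)" a b c]
    by (metis has_sum_imp_sums sums_unique2)
  moreover have "((\<lambda>(n, m). f m n) has_sum X) (UNIV \<times> UNIV)"
    using iffD1[OF has_sum_swap X] by (simp add: case_prod_unfold)
  then have "((\<lambda>n. gen_coeff a b c z n * s ^ n) has_sum X) UNIV"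
    by (rule has_sum_SigmaD) (simp add: cols)
  then have "(\<Sum>n. gen_coeff a b c z n * s ^ n) = X"
    using has_sum_imp_sums sums_unique by metis
  ultimately show ?thesis by simp
qed

section \<open>Analytic continuation in \<open>s\<close>\<close>

text \<open>
  On this half-plane \<open>1 - u\<close> has real part above \<open>|z|\<close>. Hence it avoids the cut of the logarithm,
  and \<open>z / (1 - u)\<close> stays in the unit disc.
\<close>
lemma generating_function_holomorphic:
  "(\<lambda>u. (1 - u) powr (- a) * gauss a b c (z / (1 - u))) holomorphic_on {u. Re u < 1 - norm z}"
proof -
  define H where "H = {u. Re u < 1 - norm z}"
  have Re: "Re (1 - u) > norm z" if "Re u < 1 - norm z" for u using that by simp
  have nz: "1 - u \<noteq> 0" if "Re u < 1 - norm z" for u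
  proof
    assume "1 - u = 0"
    then have "Re (1 - u) = 0" by simp
    then show False using Re[OF that] norm_ge_zero[of z] by linarith
  qed
  have br: "1 - u \<notin> \<real>\<^sub>\<le>\<^sub>0" if "Re u < 1 - norm z" for u
  proof
    assume "1 - u \<in> \<real>\<^sub>\<le>\<^sub>0"
    then have "Re (1 - u) \<le> 0" by (simp add: complex_nonpos_Reals_iff)
    then show False using Re[OF that] norm_ge_zero[of z] by linarith
  qed
  have "(\<lambda>u. z / (1 - u)) ` H \<subseteq> ball 0 1"
  proof (intro image_subsetI)
    fix u assume u: "u \<in> H"
    have "norm z < norm (1 - u)" using Re[of u] u complex_Re_le_cmod[of "1 - u"] by (simp add: H_def)
    then show "z / (1 - u) \<in> ball 0 1" by (simp add: norm_divide divide_less_eq)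
  qed
  then have "(gauss a b c \<circ> (\<lambda>u. z / (1 - u))) holomorphic_on H"
    by (intro holomorphic_on_compose_gen[OF _ gauss_holomorphic] holomorphic_intros) (use nz in \<open>auto simp: H_def\<close>)
  then have "(\<lambda>u. gauss a b c (z / (1 - u))) holomorphic_on H" by (simp only: o_def)
  moreover have "(\<lambda>u. (1 - u) powr (- a)) holomorphic_on H"
    by (intro holomorphic_intros) (use br in \<open>auto simp: H_def\<close>)
  ultimately show ?thesis unfolding H_def by (intro holomorphic_on_mult)
qed

text \<open>
  The continuation is carried out in \<open>y\<close> with \<open>u = y s\<close>, so that the disc of convergence is always
  the unit disc and \<open>s = 0\<close> is not exceptional. The domain \<open>V\<close> is the intersection of this disc with
  a half-plane, and it contains the real interval from \<open>0\<close> to \<open>1\<close>, the endpoint \<open>1\<close> excluded.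
\<close>
lemma gen_coeff_series_real:
  fixes s :: real
  assumes zs: "norm z < min 1 (1 - s)"
    and summ: "summable (\<lambda>n. gen_coeff a b c z n * of_real s ^ n)"
  shows "(\<Sum>n. gen_coeff a b c z n * of_real s ^ n)
    = of_real (1 - s) powr (- a) * gauss a b c (z / of_real (1 - s))"
proof -
  define d where "d = (\<lambda>n. gen_coeff a b c z n * of_real s ^ n)"
  define G where "G u = (1 - u) powr (- a) * gauss a b c (z / (1 - u))" for u
  define H where "H = {u. Re u < 1 - norm z}"
  have G_holo: "G holomorphic_on H"
    unfolding G_def H_def by (rule generating_function_holomorphic)
  define V where "V = ball 0 1 \<inter> (\<lambda>y. y * of_real s) -` H"
  define f where "f y = (\<Sum>n. d n * y ^ n)" for y
  have V_halfspace: "V = ball 0 1 \<inter> {y. inner (of_real s) y < 1 - norm z}"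
    unfolding V_def H_def by (auto simp: inner_complex_def mult.commute)
  have V_open: "open V" unfolding V_halfspace by (intro open_Int open_ball open_halfspace_lt)
  have V_convex: "convex V" unfolding V_halfspace by (intro convex_Int convex_ball convex_halfspace_lt)
  have f_holo: "f holomorphic_on V"
  proof -
    have "f holomorphic_on ball 0 1"
    proof (rule power_series_holomorphic[where a = d])
      fix w :: complex assume "w \<in> ball 0 1"
      then have "summable (\<lambda>n. d n * w ^ n)"
        using summ by - (rule powser_inside[of d 1 w], auto simp: d_def)
      then show "(\<lambda>n. d n * (w - 0) ^ n) sums f w" by (simp add: f_def summable_sums)
    qed
    then show ?thesis by (rule holomorphic_on_subset) (auto simp: V_def)
  qed
  have g_holo: "(\<lambda>y. G (y * of_real s)) holomorphic_on V"
  proof -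
    have "(G \<circ> (\<lambda>y. y * of_real s)) holomorphic_on V"
      by (rule holomorphic_on_compose_gen[OF _ G_holo]) (auto simp: V_def intro!: holomorphic_intros)
    then show ?thesis by (simp add: o_def)
  qed
  define V0 where "V0 = V \<inter> {y. norm z + norm (y * of_real s) < 1}"
  have V0_open: "open V0" unfolding V0_def
    by (intro open_Int V_open open_Collect_less continuous_intros)
  have V0_ne: "0 \<in> V0" using zs by (simp add: V0_def V_def H_def)
  \<comment> \<open>Close to \<open>0\<close> the interchange of sums applies.\<close>
  have agree0: "f y = G (y * of_real s)" if "y \<in> V0" for y
  proof -
    have "f y = (\<Sum>n. gen_coeff a b c z n * (y * of_real s) ^ n)"
      by (simp add: f_def d_def power_mult_distrib mult_ac)
    then show ?thesis using gen_coeff_series_small[of z "y * of_real s"] that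
      by (simp add: G_def V0_def)
  qed
  have agree: "f y = G (y * of_real s)" if "y \<in> V" for y
  proof (rule analytic_continuation_open[OF V0_open V_open _ _ _ f_holo g_holo _ that])
    show "V0 \<noteq> {}" using V0_ne by blast
    show "connected V" by (rule convex_connected[OF V_convex])
    show "V0 \<subseteq> V" unfolding V0_def by (rule Int_lower1)
  qed (rule agree0)
  have lim1: "((\<lambda>y::real. f (of_real y)) \<longlongrightarrow> (\<Sum>n. d n)) (at_left 1)"
    unfolding f_def using summ
    by - (rule power_series_tendsto_at_left_1, rule summable_sums, simp add: d_def)
  have sH: "of_real s \<in> H" using zs by (simp add: H_def)
  have "open H" unfolding H_def by (intro open_Collect_less continuous_intros)
  then have "isCont G (of_real s)"
    using holomorphic_on_imp_continuous_on[OF G_holo] sH by (simp add: continuous_on_eq_continuous_at)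
  moreover have "((\<lambda>y::real. complex_of_real y * of_real s) \<longlongrightarrow> of_real 1 * of_real s) (at_left 1)"
    by (intro tendsto_intros)
  then have "((\<lambda>y::real. complex_of_real y * of_real s) \<longlongrightarrow> of_real s) (at_left 1)" by simp
  ultimately have lim2: "((\<lambda>y::real. G (of_real y * of_real s)) \<longlongrightarrow> G (of_real s)) (at_left 1)"
    by (rule isCont_tendsto_compose)
  have "\<forall>\<^sub>F y::real in at_left 1. y \<in> {0<..<1}" by (rule eventually_at_left_real) simp
  then have "\<forall>\<^sub>F y::real in at_left 1. G (of_real y * of_real s) = f (of_real y)"
  proof eventually_elim
    case (elim y)
    have "y * s < 1 - norm z"
    proof (cases "s \<ge> 0")
      case True
      then have "y * s \<le> s" using elim by (simp add: mult_left_le_one_le)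
      then show ?thesis using zs by simp
    next
      case False
      then have "y * s \<le> 0" using elim by (simp add: mult_nonneg_nonpos)
      then show ?thesis using zs by simp
    qed
    then have "of_real y \<in> V" using elim by (simp add: V_def H_def)
    then show ?case using agree by simp
  qed
  from tendsto_cong[OF this] lim2 have "((\<lambda>y::real. f (of_real y)) \<longlongrightarrow> G (of_real s)) (at_left 1)" by simp
  from tendsto_unique[OF _ lim1 this] show ?thesis by (simp add: d_def G_def trivial_limit_at_left_real)
qed

theorem theorem15:
  fixes k t :: real and x lam \<alpha> \<beta> :: complex
  assumes "k > 0"
    and "\<forall>j::nat. \<beta> \<noteq> - (of_nat j * of_real k)"
    and "cmod x < 1 / k * min 1 (1 - k * t)"
  shows "(k * \<bar>t\<bar> < min 1 (cmod (1 - of_real k * x)) \<longrightarrow>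
            summable (\<lambda>n. kpoch k lam n / fact n *
              khyp k (lam + of_nat n * of_real k) \<alpha> \<beta> x * of_real t ^ n)) \<and>
         (summable (\<lambda>n. kpoch k lam n / fact n *
              khyp k (lam + of_nat n * of_real k) \<alpha> \<beta> x * of_real t ^ n) \<longrightarrow>
            (\<Sum>n. kpoch k lam n / fact n *
              khyp k (lam + of_nat n * of_real k) \<alpha> \<beta> x * of_real t ^ n) =
            of_real (1 - k * t) powr (- (lam / of_real k)) *
              khyp k lam \<alpha> \<beta> (x / of_real (1 - k * t)))"
proof -
  define a b c z where "a = lam / of_real k" and "b = \<alpha> / of_real k"
    and "c = \<beta> / of_real k" and "z = of_real k * x"
  have k0: "k \<noteq> 0" using assms(1) by simp
  have term_eq: "kpoch k lam n / fact n * khyp k (lam + of_nat n * of_real k) \<alpha> \<beta> x * of_real t ^ n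
      = gen_coeff a b c z n * of_real (k * t) ^ n" for n
    using k0 by (simp add: kpoch_eq_pochhammer khyp_eq_gauss gen_coeff_def a_def b_def c_def z_def
        add_divide_distrib power_mult_distrib)
  have rhs_eq: "of_real (1 - k * t) powr (- (lam / of_real k)) * khyp k lam \<alpha> \<beta> (x / of_real (1 - k * t))
      = of_real (1 - k * t) powr (- a) * gauss a b c (z / of_real (1 - k * t))"
    using k0 by (simp add: khyp_eq_gauss a_def b_def c_def z_def)
  have zt: "norm z < min 1 (1 - k * t)"
    using assms(1,3) by (simp add: z_def norm_mult field_simps)
  have c: "c + of_nat j \<noteq> 0" for j
    using assms(2) k0 by (simp add: c_def field_simps add_eq_0_iff2)
  have "norm (complex_of_real (k * t)) = k * \<bar>t\<bar>"
    using assms(1) by (simp add: abs_mult norm_mult)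
  then show ?thesis
    unfolding term_eq rhs_eq
    using summable_gen_coeff[OF _ c, of z "of_real (k * t)" a b] zt
      gen_coeff_series_real[OF zt, of a b c]
    by (simp add: z_def)
qed

end
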